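(* Let $p,q$ be positive integers and $n=p+q$. For any element $\mathcal{A}\in U(p,q)$, the associated matrix $\sqrt{\mathcal{A}^*\mathcal{A}}$ can be expressed uniquely as $e^Y$ for $Y\in\mathfrak{n}$. Moreover, there is a unique way to express $\mathcal{A}$ as a product $Ue^{Y}$ of a unitary matrix $U$ and an element $e^Y$ of $e^{\mathfrak{n}}$, and it is given by the polar decomposition $\mathcal{A}=\mathcal{A}\left(\sqrt{\mathcal{A}^*\mathcal{A}}\right)^{-1}\sqrt{\mathcal{A}^*\mathcal{A}}$.
   Context: Let $I_{p,q}=\begin{pmatrix} I_p & 0 \\ 0 & -I_q \end{pmatrix}$. The indefinite unitary group is $U(p,q)=\{\mathcal{A}\in GL(n,\mathbb{C}):\mathcal{A}^*I_{p,q}\mathcal{A}=I_{p,q}\}$, where $*$ is conjugate transpose, and its Lie algebra is $\mathfrak{u}_{p,q}=\{X\in M_n(\mathbb{C}):X^*I_{p,q}+I_{p,q}X=0\}$, with inner product $\langle X,Y\rangle=\mathrm{trace}(X^*Y)$. The subspace $\mathfrak{n}\subset\mathfrak{u}_{p,q}$ is the orthogonal complement of the Lie algebra $\mathfrak{u}_p\oplus\mathfrak{u}_q$ of $U(p)\times U(q)$; explicitly $\mathfrak{n}=\left\{\begin{pmatrix} 0 & B \\ B^* & 0 \end{pmatrix}: B\in M_{p,q}(\mathbb{C})\right\}$, with $M_{p,q}(\mathbb C)$ the $p\times q$ complex matrices. $\sqrt{\mathcal{A}^*\mathcal{A}}$ is the unique Hermitian positive definite square root and $e^{\mathfrak{n}}=\{e^Y:Y\in\mathfrak{n}\}$.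 *)

theory Defs
  imports
    Complex_Main
    "Jordan_Normal_Form.Gauss_Jordan_Elimination"
    "Jordan_Normal_Form.Schur_Decomposition"
begin

definition mat_trace :: "'a :: comm_monoid_add mat \<Rightarrow> 'a" where
  "mat_trace A = (\<Sum>i<dim_row A. A $$ (i, i))"

definition I_pq :: "nat \<Rightarrow> nat \<Rightarrow> complex mat" where
  "I_pq p q = four_block_mat (1\<^sub>m p) (0\<^sub>m p q) (0\<^sub>m q p) (- 1\<^sub>m q)"

definition U_pq :: "nat \<Rightarrow> nat \<Rightarrow> complex mat set" where
  "U_pq p q = {A \<in> carrier_mat (p + q) (p + q).
     invertible_mat A \<and> mat_adjoint A * I_pq p q * A = I_pq p q}"

definition u_pq :: "nat \<Rightarrow> nat \<Rightarrow> complex mat set" where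
  "u_pq p q = {X \<in> carrier_mat (p + q) (p + q).
     mat_adjoint X * I_pq p q + I_pq p q * X = 0\<^sub>m (p + q) (p + q)}"

definition unitary_mat :: "nat \<Rightarrow> complex mat \<Rightarrow> bool" where
  "unitary_mat n U \<longleftrightarrow> U \<in> carrier_mat n n \<and> mat_adjoint U * U = 1\<^sub>m n"

definition u_skew :: "nat \<Rightarrow> complex mat set" where
  "u_skew n = {X \<in> carrier_mat n n. mat_adjoint X + X = 0\<^sub>m n n}"

text \<open>The Lie algebra of \<open>U(p) \<times> U(q)\<close>, embedded block-diagonally.\<close>

definition u_p_plus_u_q :: "nat \<Rightarrow> nat \<Rightarrow> complex mat set" where
  "u_p_plus_u_q p q =
     {four_block_mat a (0\<^sub>m p q) (0\<^sub>m q p) d | a d. a \<in> u_skew p \<and> d \<in> u_skew q}"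

text \<open>The orthogonal complement in \<open>u_pq\<close> for the inner product \<open>\<langle>X, Z\<rangle> = trace (X\<^sup>* Z)\<close>;
  the explicit block form is \<open>n_space_explicit\<close> below.\<close>

definition n_space :: "nat \<Rightarrow> nat \<Rightarrow> complex mat set" where
  "n_space p q =
     {X \<in> u_pq p q. \<forall>Z \<in> u_p_plus_u_q p q. mat_trace (mat_adjoint X * Z) = 0}"

text \<open>The matrix type carries no topology, so the exponential series is summed entrywise;
  it always converges, see \<open>summable_mat_exp\<close> below.\<close>

definition mat_exp :: "complex mat \<Rightarrow> complex mat" where
  "mat_exp X = mat (dim_row X) (dim_row X)
     (\<lambda>(i, j). \<Sum>k. (X ^\<^sub>m k) $$ (i, j) / fact k)"

definition hermitian_pos_def :: "nat \<Rightarrow> complex mat \<Rightarrow> bool" where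
  "hermitian_pos_def n P \<longleftrightarrow> P \<in> carrier_mat n n \<and> mat_adjoint P = P \<and>
     (\<forall>v \<in> carrier_vec n. v \<noteq> 0\<^sub>v n \<longrightarrow> 0 < Re ((P *\<^sub>v v) \<bullet>c v))"

definition mat_sqrt :: "complex mat \<Rightarrow> complex mat" where
  "mat_sqrt P = (THE S. hermitian_pos_def (dim_row P) S \<and> S * S = P)"

lemma mat_adjoint_carrier: "A \<in> carrier_mat m n \<Longrightarrow> mat_adjoint A \<in> carrier_mat n m"
  by (auto simp: mat_adjoint_def)

lemma mat_adjoint_index:
  fixes A :: "complex mat"
  assumes "A \<in> carrier_mat m n" "i < n" "j < m"
  shows "mat_adjoint A $$ (i, j) = cnj (A $$ (j, i))"
  using assms by (auto simp: mat_adjoint_def mat_of_rows_def)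

lemma summable_mat_exp:
  fixes X :: "complex mat"
  assumes X: "X \<in> carrier_mat n n" and ij: "i < n" "j < n"
  shows "summable (\<lambda>k. (X ^\<^sub>m k) $$ (i, j) / fact k)"
proof -
  define M where "M = Max ((\<lambda>(i, j). norm (X $$ (i, j))) ` ({..<n} \<times> {..<n}))"
  have M: "norm (X $$ (a, b)) \<le> M" if "a < n" "b < n" for a b
    unfolding M_def by (rule Max_ge) (use that in \<open>auto intro!: rev_image_eqI[of "(a, b)"]\<close>)
  have M0: "0 \<le> M" using M[OF ij] norm_ge_zero order_trans by blast
  have bound: "\<forall>a<n. \<forall>b<n. norm ((X ^\<^sub>m k) $$ (a, b)) \<le> (real n * M) ^ k" for k
  proof (induction k)
    case 0
    show ?case using X by auto
  next
    case (Suc k)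
    show ?case
    proof (intro allI impI)
      fix a b assume ab: "a < n" "b < n"
      have "(X ^\<^sub>m Suc k) $$ (a, b) = (\<Sum>l<n. (X ^\<^sub>m k) $$ (a, l) * X $$ (l, b))"
        using X ab by (simp add: scalar_prod_def lessThan_atLeast0)
      also have "norm \<dots> \<le> (\<Sum>l<n. norm ((X ^\<^sub>m k) $$ (a, l) * X $$ (l, b)))"
        by (rule norm_sum)
      also have "\<dots> \<le> (\<Sum>l<n. (real n * M) ^ k * M)"
        using Suc.IH M M0 ab by (intro sum_mono) (auto simp: norm_mult intro!: mult_mono)
      also have "\<dots> = (real n * M) ^ Suc k" by simp
      finally show "norm ((X ^\<^sub>m Suc k) $$ (a, b)) \<le> (real n * M) ^ Suc k" .
    qed
  qed
  show ?thesis
  proof (rule summable_comparison_test'[of "\<lambda>k. inverse (fact k) * (real n * M) ^ k" 0])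
    show "summable (\<lambda>k. inverse (fact k) * (real n * M) ^ k)" by (rule summable_exp)
    show "norm ((X ^\<^sub>m k) $$ (i, j) / fact k) \<le> inverse (fact k) * (real n * M) ^ k" for k
      using bound[of k] ij by (simp add: norm_divide field_simps)
  qed
qed

lemma I_pq_carrier: "I_pq p q \<in> carrier_mat (p + q) (p + q)"
  by (auto simp: I_pq_def)

lemma I_pq_index:
  assumes "i < p + q" "j < p + q"
  shows "I_pq p q $$ (i, j) = (if i = j then (if i < p then 1 else - 1) else 0)"
  using assms by (auto simp: I_pq_def)

lemma u_pq_iff:
  "X \<in> u_pq p q \<longleftrightarrow> X \<in> carrier_mat (p + q) (p + q) \<and>
     (\<forall>i<p + q. \<forall>j<p + q. cnj (X $$ (j, i)) * (if j < p then 1 else - 1)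
        + (if i < p then 1 else - 1) * X $$ (i, j) = 0)"
proof (cases "X \<in> carrier_mat (p + q) (p + q)")
  case True
  let ?n = "p + q"
  let ?L = "mat_adjoint X * I_pq p q + I_pq p q * X"
  have L: "?L \<in> carrier_mat ?n ?n"
    using mat_adjoint_carrier[OF True] I_pq_carrier[of p q] True by auto
  have "?L $$ (i, j) = cnj (X $$ (j, i)) * (if j < p then 1 else - 1)
        + (if i < p then 1 else - 1) * X $$ (i, j)" if ij: "i < ?n" "j < ?n" for i j
  proof -
    have "(mat_adjoint X * I_pq p q) $$ (i, j)
        = (\<Sum>l<?n. mat_adjoint X $$ (i, l) * I_pq p q $$ (l, j))"
      using mat_adjoint_carrier[OF True] I_pq_carrier[of p q] ij
      by (simp add: scalar_prod_def lessThan_atLeast0)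
    also have "\<dots> = (\<Sum>l<?n. if l = j then cnj (X $$ (j, i)) * (if j < p then 1 else - 1) else 0)"
      by (intro sum.cong) (use ij in \<open>auto simp: I_pq_index mat_adjoint_index[OF True]\<close>)
    also have "\<dots> = cnj (X $$ (j, i)) * (if j < p then 1 else - 1)"
      using ij by simp
    finally have 1: "(mat_adjoint X * I_pq p q) $$ (i, j)
        = cnj (X $$ (j, i)) * (if j < p then 1 else - 1)" .
    have "(I_pq p q * X) $$ (i, j) = (\<Sum>l<?n. I_pq p q $$ (i, l) * X $$ (l, j))"
      using True I_pq_carrier[of p q] ij by (simp add: scalar_prod_def lessThan_atLeast0)
    also have "\<dots> = (\<Sum>l<?n. if l = i then (if i < p then 1 else - 1) * X $$ (i, j) else 0)"
      by (intro sum.cong) (use ij in \<open>auto simp: I_pq_index\<close>)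
    also have "\<dots> = (if i < p then 1 else - 1) * X $$ (i, j)"
      using ij by simp
    finally have 2: "(I_pq p q * X) $$ (i, j) = (if i < p then 1 else - 1) * X $$ (i, j)" .
    show ?thesis
      using 1 2 ij True I_pq_carrier[of p q] by simp
  qed
  then show ?thesis
    using True L unfolding u_pq_def by (auto simp: mat_eq_iff)
qed (simp add: u_pq_def)

lemma trace_adjoint_mult:
  fixes X Z :: "complex mat"
  assumes "X \<in> carrier_mat n n" "Z \<in> carrier_mat n n"
  shows "mat_trace (mat_adjoint X * Z) = (\<Sum>i<n. \<Sum>j<n. cnj (X $$ (j, i)) * Z $$ (j, i))"
proof -
  have a: "mat_adjoint X \<in> carrier_mat n n" by (rule mat_adjoint_carrier[OF assms(1)])
  have "mat_trace (mat_adjoint X * Z)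
      = (\<Sum>i<n. \<Sum>j<n. mat_adjoint X $$ (i, j) * Z $$ (j, i))"
    using a assms(2) by (simp add: mat_trace_def scalar_prod_def lessThan_atLeast0)
  also have "\<dots> = (\<Sum>i<n. \<Sum>j<n. cnj (X $$ (j, i)) * Z $$ (j, i))"
    by (intro sum.cong refl) (auto simp: mat_adjoint_index[OF assms(1)])
  finally show ?thesis .
qed

theorem n_space_explicit:
  "n_space p q =
     {four_block_mat (0\<^sub>m p p) B (mat_adjoint B) (0\<^sub>m q q) | B. B \<in> carrier_mat p q}"
  (is "_ = ?R")
proof (intro equalityI subsetI)
  let ?n = "p + q"
  fix X assume "X \<in> n_space p q"
  then have Xu: "X \<in> u_pq p q"
    and orth: "\<And>Z. Z \<in> u_p_plus_u_q p q \<Longrightarrow> mat_trace (mat_adjoint X * Z) = 0"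
    by (auto simp: n_space_def)
  from Xu have X: "X \<in> carrier_mat ?n ?n"
    and E: "\<And>i j. i < ?n \<Longrightarrow> j < ?n \<Longrightarrow> cnj (X $$ (j, i)) * (if j < p then 1 else - 1)
        + (if i < p then 1 else - 1) * X $$ (i, j) = 0"
    by (auto simp: u_pq_iff)
  define a where "a = mat p p (\<lambda>(i, j). X $$ (i, j))"
  define d where "d = mat q q (\<lambda>(i, j). X $$ (i + p, j + p))"
  define B where "B = mat p q (\<lambda>(i, j). X $$ (i, j + p))"
  have ac: "a \<in> carrier_mat p p" and dc: "d \<in> carrier_mat q q" and Bc: "B \<in> carrier_mat p q"
    by (auto simp: a_def d_def B_def)
  have "a \<in> u_skew p"
  proof -
    have "cnj (X $$ (j, i)) + X $$ (i, j) = 0" if "i < p" "j < p" for i j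
      using E[of i j] that by simp
    then have "cnj (a $$ (j, i)) + a $$ (i, j) = 0" if "i < p" "j < p" for i j
      using that by (simp add: a_def)
    then show ?thesis
      unfolding u_skew_def using ac mat_adjoint_carrier[OF ac]
      by (auto intro!: eq_matI simp: mat_adjoint_index[OF ac])
  qed
  moreover have "d \<in> u_skew q"
  proof -
    have "cnj (X $$ (j + p, i + p)) + X $$ (i + p, j + p) = 0" if "i < q" "j < q" for i j
      using E[of "i + p" "j + p"] that by (simp add: add_eq_0_iff)
    then have "cnj (d $$ (j, i)) + d $$ (i, j) = 0" if "i < q" "j < q" for i j
      using that by (simp add: d_def)
    then show ?thesis
      unfolding u_skew_def using dc mat_adjoint_carrier[OF dc]
      by (auto intro!: eq_matI simp: mat_adjoint_index[OF dc])
  qed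
  ultimately have Zin: "four_block_mat a (0\<^sub>m p q) (0\<^sub>m q p) d \<in> u_p_plus_u_q p q"
    (is "?Z \<in> _") by (auto simp: u_p_plus_u_q_def)
  have Zc: "?Z \<in> carrier_mat ?n ?n" using ac dc by auto
  have Zi: "?Z $$ (j, i) = (if (i < p \<longleftrightarrow> j < p) then X $$ (j, i) else 0)"
    if "i < ?n" "j < ?n" for i j
    using that ac dc by (auto simp: a_def d_def)
  have "0 = Re (mat_trace (mat_adjoint X * ?Z))" using orth[OF Zin] by simp
  also have "\<dots> = (\<Sum>i<?n. \<Sum>j<?n. Re (cnj (X $$ (j, i)) * ?Z $$ (j, i)))"
    by (simp only: trace_adjoint_mult[OF X Zc] Re_sum)
  also have "\<dots> = (\<Sum>i<?n. \<Sum>j<?n. if (i < p \<longleftrightarrow> j < p) then (norm (X $$ (j, i)))\<^sup>2 else 0)"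
    by (intro sum.cong refl, subst Zi) (auto simp: cmod_def power2_eq_square)
  finally have "(\<Sum>i<?n. \<Sum>j<?n. if (i < p \<longleftrightarrow> j < p) then (norm (X $$ (j, i)))\<^sup>2 else 0) = 0"
    by simp
  then have van: "X $$ (j, i) = 0" if "i < ?n" "j < ?n" "i < p \<longleftrightarrow> j < p" for i j
    using that by (subst (asm) sum_nonneg_eq_0_iff; force simp: sum_nonneg sum_nonneg_eq_0_iff)
  have "X = four_block_mat (0\<^sub>m p p) B (mat_adjoint B) (0\<^sub>m q q)"
  proof (rule eq_matI)
    fix i j
    assume "i < dim_row (four_block_mat (0\<^sub>m p p) B (mat_adjoint B) (0\<^sub>m q q))"
      "j < dim_col (four_block_mat (0\<^sub>m p p) B (mat_adjoint B) (0\<^sub>m q q))"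
    then have ij: "i < ?n" "j < ?n" by auto
    show "X $$ (i, j) = four_block_mat (0\<^sub>m p p) B (mat_adjoint B) (0\<^sub>m q q) $$ (i, j)"
    proof (cases "i < p \<longleftrightarrow> j < p")
      case True
      then show ?thesis using van[of j i] ij by auto
    next
      case False
      have "X $$ (i, j) = cnj (X $$ (j, i))" using E[OF ij] False by (auto split: if_splits)
      then show ?thesis
        using False ij mat_adjoint_carrier[OF Bc]
        by (auto simp: B_def mat_adjoint_index[OF Bc, unfolded B_def])
    qed
  qed (use X in auto)
  then show "X \<in> ?R" using Bc by blast
next
  let ?n = "p + q"
  fix X assume "X \<in> ?R"
  then obtain B where Bc: "B \<in> carrier_mat p q"
    and X: "X = four_block_mat (0\<^sub>m p p) B (mat_adjoint B) (0\<^sub>m q q)" by auto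
  have Xc: "X \<in> carrier_mat ?n ?n" by (auto simp: X)
  have Xi: "X $$ (i, j) = (if i < p then (if j < p then 0 else B $$ (i, j - p))
      else (if j < p then cnj (B $$ (j, i - p)) else 0))" if "i < ?n" "j < ?n" for i j
    using that Bc mat_adjoint_carrier[OF Bc] by (auto simp: X mat_adjoint_index[OF Bc])
  have "X \<in> u_pq p q"
    unfolding u_pq_iff using Xc by (auto simp: Xi)
  moreover have "mat_trace (mat_adjoint X * Z) = 0" if "Z \<in> u_p_plus_u_q p q" for Z
  proof -
    from that obtain a d where ac: "a \<in> carrier_mat p p" and dc: "d \<in> carrier_mat q q"
      and Z: "Z = four_block_mat a (0\<^sub>m p q) (0\<^sub>m q p) d"
      by (auto simp: u_p_plus_u_q_def u_skew_def)
    have Zc: "Z \<in> carrier_mat ?n ?n" using ac dc by (auto simp: Z)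
    have "cnj (X $$ (j, i)) * Z $$ (j, i) = 0" if "i < ?n" "j < ?n" for i j
      using that ac dc by (auto simp: Xi Z)
    then show ?thesis
      unfolding trace_adjoint_mult[OF Xc Zc] by (intro sum.neutral ballI) simp_all
  qed
  ultimately show "X \<in> n_space p q" by (auto simp: n_space_def)
qed

end

theory Submission
  imports Defs "Jordan_Normal_Form.Jordan_Normal_Form_Existence"
begin

text \<open>A Hermitian matrix \<open>H = P D P\<inverse>\<close> has a real functional calculus \<open>f(H) = P f(D) P\<inverse>\<close>, and
  \<open>X H = K X\<close> implies \<open>X f(H) = f(K) X\<close>. With \<open>X = 1\<close> this makes \<open>f(H)\<close> independent of the
  diagonalisation, so that \<open>sqrt\<close> and \<open>ln\<close> recover \<open>S\<close> from \<open>S\<^sup>2\<close> and \<open>Y\<close> from \<open>e\<^sup>Y\<close>: this gives all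
  uniqueness claims. For \<open>A \<in> U(p,q)\<close> the matrix \<open>P = A\<^sup>* A\<close> satisfies \<open>I\<^sub>p\<^sub>q P = P\<inverse> I\<^sub>p\<^sub>q\<close>, so its
  logarithm anticommutes with \<open>I\<^sub>p\<^sub>q\<close>, and the Hermitian matrices with this property are
  exactly the elements of \<open>n_space\<close>.\<close>

section \<open>Adjoints\<close>

lemma mat_adjoint_mult:
  fixes A B :: "complex mat"
  assumes A: "A \<in> carrier_mat m n" and B: "B \<in> carrier_mat n k"
  shows "mat_adjoint (A * B) = mat_adjoint B * mat_adjoint A"
proof (rule eq_matI)
  note A' = mat_adjoint_carrier[OF A] and B' = mat_adjoint_carrier[OF B]
  have AB: "A * B \<in> carrier_mat m k" using A B by simp
  note AB' = mat_adjoint_carrier[OF AB]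
  fix i j assume "i < dim_row (mat_adjoint B * mat_adjoint A)"
    "j < dim_col (mat_adjoint B * mat_adjoint A)"
  then have ij: "i < k" "j < m" using A' B' by auto
  show "mat_adjoint (A * B) $$ (i, j) = (mat_adjoint B * mat_adjoint A) $$ (i, j)"
    unfolding mat_adjoint_index[OF AB ij] using A B A' B' ij
    by (simp add: scalar_prod_def mat_adjoint_index[OF A] mat_adjoint_index[OF B] mult.commute)
qed (use mat_adjoint_carrier[OF A] mat_adjoint_carrier[OF B]
      mat_adjoint_carrier[OF mult_carrier_mat[OF A B]] in auto)

lemma mat_adjoint_adjoint:
  fixes A :: "complex mat"
  assumes A: "A \<in> carrier_mat m n"
  shows "mat_adjoint (mat_adjoint A) = A"
  using A mat_adjoint_carrier[OF A] mat_adjoint_carrier[OF mat_adjoint_carrier[OF A]]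
  by (intro eq_matI)
    (auto simp: mat_adjoint_index[OF A] mat_adjoint_index[OF mat_adjoint_carrier[OF A]])

lemma mat_adjoint_one: "mat_adjoint (1\<^sub>m n :: complex mat) = 1\<^sub>m n"
  using mat_adjoint_carrier[OF one_carrier_mat[of n]]
  by (intro eq_matI) (auto simp: mat_adjoint_index[OF one_carrier_mat])

lemma mat_adjoint_real_diag:
  "mat_adjoint (mat_diag n (\<lambda>i. complex_of_real (d i))) = mat_diag n (\<lambda>i. complex_of_real (d i))"
    (is "mat_adjoint ?D = ?D")
proof (rule eq_matI)
  fix i j assume "i < dim_row ?D" "j < dim_col ?D"
  then have ij: "i < n" "j < n" by (auto simp: mat_diag_def)
  show "mat_adjoint ?D $$ (i, j) = ?D $$ (i, j)"
    unfolding mat_adjoint_index[OF mat_diag_dim ij] using ij by (simp add: mat_diag_def)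
qed (use mat_adjoint_carrier[OF mat_diag_dim, of n "\<lambda>i. complex_of_real (d i)"]
      in \<open>auto simp: mat_diag_def\<close>)

lemma mat_adjoint_inner:
  fixes A :: "complex mat"
  assumes A: "A \<in> carrier_mat m n" and v: "v \<in> carrier_vec n" and w: "w \<in> carrier_vec m"
  shows "(mat_adjoint A *\<^sub>v w) \<bullet>c v = w \<bullet>c (A *\<^sub>v v)"
proof -
  note A' = mat_adjoint_carrier[OF A]
  have "(mat_adjoint A *\<^sub>v w) \<bullet>c v = (\<Sum>i<n. \<Sum>j<m. cnj (A $$ (j, i)) * w $ j * cnj (v $ i))"
    using A A' v w
    by (simp add: scalar_prod_def lessThan_atLeast0 mat_adjoint_index[OF A] sum_distrib_right)
  also have "\<dots> = (\<Sum>j<m. \<Sum>i<n. cnj (A $$ (j, i)) * w $ j * cnj (v $ i))"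
    by (rule sum.swap)
  also have "\<dots> = w \<bullet>c (A *\<^sub>v v)"
    using A v w
    by (simp add: scalar_prod_def lessThan_atLeast0 sum_distrib_left mult_ac)
  finally show ?thesis .
qed

section \<open>Hermitian and positive definite matrices\<close>

definition hermitian_mat :: "nat \<Rightarrow> complex mat \<Rightarrow> bool" where
  "hermitian_mat n H \<longleftrightarrow> H \<in> carrier_mat n n \<and> mat_adjoint H = H"

lemma hermitian_matD:
  assumes "hermitian_mat n H"
  shows "H \<in> carrier_mat n n" "mat_adjoint H = H"
  using assms by (auto simp: hermitian_mat_def)

lemma hermitian_mat_index:
  assumes "hermitian_mat n H" "i < n" "j < n"
  shows "H $$ (i, j) = cnj (H $$ (j, i))"
  using assms mat_adjoint_index[of H n n i j] by (auto simp: hermitian_mat_def)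

text \<open>A Jordan basis need not be unitary, so similarity may destroy Hermitian symmetry;
  congruence by the same basis keeps it.\<close>

lemma hermitian_congruence:
  assumes H: "hermitian_mat n H" and X: "X \<in> carrier_mat n m"
  shows "hermitian_mat m (mat_adjoint X * H * X)"
proof -
  note Hc = hermitian_matD[OF H] and X' = mat_adjoint_carrier[OF X]
  have "mat_adjoint (mat_adjoint X * H * X) = mat_adjoint X * mat_adjoint (mat_adjoint X * H)"
    by (rule mat_adjoint_mult[of _ m n]) (use Hc X X' in auto)
  also have "mat_adjoint (mat_adjoint X * H) = H * X"
    using mat_adjoint_mult[OF X' Hc(1)] Hc(2) mat_adjoint_adjoint[OF X] by simp
  finally show ?thesis using Hc X X' by (simp add: hermitian_mat_def)
qed

lemma hermitian_one: "hermitian_mat n (1\<^sub>m n)"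
  by (simp add: hermitian_mat_def mat_adjoint_one)

lemma hermitian_adjoint_mult:
  assumes X: "X \<in> carrier_mat n m"
  shows "hermitian_mat m (mat_adjoint X * X)"
  using hermitian_congruence[OF hermitian_one X] mat_adjoint_carrier[OF X] by simp

lemma hermitian_pos_def_imp_hermitian: "hermitian_pos_def n H \<Longrightarrow> hermitian_mat n H"
  by (simp add: hermitian_pos_def_def hermitian_mat_def)

text \<open>The quadratic form at \<open>v\<close> is the squared norm of \<open>X v\<close>, and
  the left inverse \<open>Z\<close> prevents \<open>X v\<close> from vanishing. This serves both the
  Gram matrix of a group element and positive functions of a Hermitian matrix.\<close>

lemma hermitian_pos_def_adjoint_mult:
  assumes X: "X \<in> carrier_mat n n" and Z: "Z \<in> carrier_mat n n" and ZX: "Z * X = 1\<^sub>m n"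
  shows "hermitian_pos_def n (mat_adjoint X * X)"
  unfolding hermitian_pos_def_def
proof (intro conjI ballI impI)
  note H = hermitian_adjoint_mult[OF X]
  show "mat_adjoint X * X \<in> carrier_mat n n" "mat_adjoint (mat_adjoint X * X) = mat_adjoint X * X"
    using hermitian_matD[OF H] by auto
  fix v :: "complex vec" assume v: "v \<in> carrier_vec n" "v \<noteq> 0\<^sub>v n"
  let ?w = "X *\<^sub>v v"
  have w: "?w \<in> carrier_vec n" using X v by simp
  have "Z *\<^sub>v ?w = v" using assoc_mult_mat_vec[OF Z X v(1)] ZX v by simp
  moreover have "Z *\<^sub>v 0\<^sub>v n = 0\<^sub>v n" using Z by (intro eq_vecI) auto
  ultimately have "?w \<noteq> 0\<^sub>v n" using v by auto
  then have "0 < ?w \<bullet>c ?w" using w by simp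
  moreover have "((mat_adjoint X * X) *\<^sub>v v) \<bullet>c v = ?w \<bullet>c ?w"
    using assoc_mult_mat_vec[OF mat_adjoint_carrier[OF X] X v(1)]
      mat_adjoint_inner[OF X v(1) w] by simp
  ultimately show "0 < Re (((mat_adjoint X * X) *\<^sub>v v) \<bullet>c v)"
    by (simp add: less_complex_def)
qed

section \<open>Diagonalisation of Hermitian matrices\<close>

text \<open>Induction peels off the leading block. A nonzero entry cannot straddle two blocks, and
  inside one block it sits on the superdiagonal, between two copies of the same eigenvalue.\<close>

lemma jordan_matrix_off_diagonal:
  fixes n_as :: "(nat \<times> complex) list"
  assumes "i < sum_list (map fst n_as)" "j < sum_list (map fst n_as)"
    and "i \<noteq> j" "jordan_matrix n_as $$ (i, j) \<noteq> 0"
  shows "j = Suc i \<and> jordan_matrix n_as $$ (i, j) = 1 \<and>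
    jordan_matrix n_as $$ (i, i) = jordan_matrix n_as $$ (j, j)"
  using assms
proof (induction n_as arbitrary: i j)
  case (Cons na nas)
  obtain m a where na: "na = (m, a)" by force
  let ?N = "sum_list (map fst nas)"
  have eq: "jordan_matrix (na # nas) $$ (k, l) =
      (if k < m then if l < m then jordan_block m a $$ (k, l) else 0
       else if l < m then 0 else jordan_matrix nas $$ (k - m, l - m))"
    if "k < m + ?N" "l < m + ?N" for k l
    using that by (simp add: na jordan_matrix_Cons)
  have ij: "i < m + ?N" "j < m + ?N" using Cons.prems by (auto simp: na)
  show ?case
  proof (cases "i < m")
    case True
    then show ?thesis using Cons.prems(3,4) ij
      by (auto simp: eq jordan_block_def split: if_splits)
  next
    case False
    then have j: "\<not> j < m" using Cons.prems(4) ij by (auto simp: eq)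
    have "i - m < ?N" "j - m < ?N" "i - m \<noteq> j - m" "jordan_matrix nas $$ (i - m, j - m) \<noteq> 0"
      using Cons.prems(3,4) ij False j by (auto simp: eq)
    from Cons.IH[OF this] False j ij show ?thesis by (auto simp: eq)
  qed
qed simp

lemma mult_mat_index:
  assumes "A \<in> carrier_mat m n" "B \<in> carrier_mat n k" "i < m" "j < k"
  shows "(A * B) $$ (i, j) = (\<Sum>l<n. A $$ (i, l) * B $$ (l, j))"
  using assms by (simp add: scalar_prod_def lessThan_atLeast0)

text \<open>In a Jordan basis \<open>P\<close>, the matrix \<open>K = P\<^sup>* H P = G J\<close> is Hermitian, where \<open>G = P\<^sup>* P\<close>. If \<open>j = i + 1\<close>
  is the first non-diagonal column of \<open>J\<close>, computing \<open>K\<^sub>i\<^sub>j\<close> from column \<open>j\<close> and from column \<open>i\<close>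
  yields \<open>G\<^sub>i\<^sub>i = 0\<close>, which is impossible.\<close>

theorem hermitian_diagonalisable:
  assumes H: "hermitian_mat n H"
  obtains P Q d where "P \<in> carrier_mat n n" "Q \<in> carrier_mat n n" "P * Q = 1\<^sub>m n" "Q * P = 1\<^sub>m n"
    "H = P * mat_diag n (\<lambda>i. complex_of_real (d i)) * Q"
proof -
  note Hc = hermitian_matD(1)[OF H]
  obtain es where "char_poly H = (\<Prod>e \<leftarrow> es. [:- e, 1:])"
    using char_poly_factorized[OF Hc] by blast
  then obtain n_as where jnf: "jordan_nf H n_as" using jordan_nf_exists[OF Hc] by blast
  define J where "J = jordan_matrix n_as"
  from jnf have "similar_mat H J" by (simp add: jordan_nf_def J_def)
  then obtain P Q where "similar_mat_wit H J P Q" unfolding similar_mat_def by blast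
  note w = similar_mat_witD2[OF Hc this]
  have PQ: "P \<in> carrier_mat n n" "Q \<in> carrier_mat n n" "P * Q = 1\<^sub>m n" "Q * P = 1\<^sub>m n"
    and J: "J \<in> carrier_mat n n" and HJ: "H = P * J * Q" using w by auto
  have N: "sum_list (map fst n_as) = n"
    using J jordan_matrix_carrier[of n_as] by (auto simp: J_def)
  note P' = mat_adjoint_carrier[OF PQ(1)]
  define G where "G = mat_adjoint P * P"
  define K where "K = mat_adjoint P * H * P"
  have G: "hermitian_mat n G" unfolding G_def by (rule hermitian_adjoint_mult[OF PQ(1)])
  have K: "hermitian_mat n K" unfolding K_def by (rule hermitian_congruence[OF H PQ(1)])
  note Gc = hermitian_matD(1)[OF G]
  have "H * P = P * J"
  proof -
    have "H * P = P * J * (Q * P)"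
      unfolding HJ by (rule assoc_mult_mat) (use PQ J in auto)
    then show ?thesis using PQ J by simp
  qed
  then have KGJ: "K = G * J"
    unfolding K_def G_def using P' Hc PQ(1) J by simp
  have K_index: "K $$ (i, j) = (\<Sum>l<n. G $$ (i, l) * J $$ (l, j))" if "i < n" "j < n" for i j
    unfolding KGJ by (rule mult_mat_index[OF Gc J that])
  \<comment> \<open>The entry is the squared norm of column \<open>i\<close> of \<open>P\<close>; a
    zero column would contradict \<open>Q * P = 1\<close>.\<close>
  have G_nz: "G $$ (i, i) \<noteq> 0" if i: "i < n" for i
  proof
    assume "G $$ (i, i) = 0"
    moreover have "G $$ (i, i) = complex_of_real (\<Sum>l<n. (norm (P $$ (l, i)))\<^sup>2)"
      unfolding G_def mult_mat_index[OF P' PQ(1) i i]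
      using i by (simp add: mat_adjoint_index[OF PQ(1)] complex_norm_square mult.commute del: of_real_power)
    ultimately have "(\<Sum>l<n. (norm (P $$ (l, i)))\<^sup>2) = 0" by (metis of_real_eq_0_iff)
    then have "P $$ (l, i) = 0" if "l < n" for l
      using that by (subst (asm) sum_nonneg_eq_0_iff) auto
    then have "(Q * P) $$ (i, i) = 0"
      using mult_mat_index[OF PQ(2,1) i i] by simp
    then show False using PQ(4) i by simp
  qed
  have K_eigen: "K $$ (k, i) = G $$ (k, i) * J $$ (i, i)"
    if "k < n" "i < n" "\<And>l. l < n \<Longrightarrow> l \<noteq> i \<Longrightarrow> J $$ (l, i) = 0" for k i
  proof -
    have "K $$ (k, i) = (\<Sum>l<n. if l = i then G $$ (k, i) * J $$ (i, i) else 0)"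
      unfolding K_index[OF that(1,2)] by (intro sum.cong) (use that in auto)
    then show ?thesis using that by simp
  qed
  \<comment> \<open>Both \<open>K\<close> and \<open>G\<close> have real diagonals, and the nonzero
    \<open>G $$ (i, i)\<close> can be cancelled from the relation \<open>K_eigen\<close> at
    \<open>(i, i)\<close>.\<close>
  have real_eigen: "cnj (J $$ (i, i)) = J $$ (i, i)"
    if i: "i < n" "\<And>l. l < n \<Longrightarrow> l \<noteq> i \<Longrightarrow> J $$ (l, i) = 0" for i
    using hermitian_mat_index[OF K i(1) i(1)] hermitian_mat_index[OF G i(1) i(1)] G_nz[OF i(1)]
      K_eigen[OF i(1) i] by auto
  have diag: "J $$ (i, j) = 0" if "i < n" "j < n" "i \<noteq> j" for i j
    using that
  proof (induction j arbitrary: i rule: less_induct)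
    case (less j)
    show ?case
    proof (rule ccontr)
      assume nz: "J $$ (i, j) \<noteq> 0"
      with jordan_matrix_off_diagonal[of i n_as j] less.prems N
      have ji: "j = Suc i" and J1: "J $$ (i, j) = 1" and Jij: "J $$ (i, i) = J $$ (j, j)"
        by (auto simp: J_def)
      have van: "J $$ (l, j) = 0" if "l < n" "l \<noteq> i" "l \<noteq> j" for l
        using jordan_matrix_off_diagonal[of l n_as j] that less.prems N ji
        by (auto simp: J_def)
      have col: "J $$ (l, i) = 0" if "l < n" "l \<noteq> i" for l
        using less.IH[of i l] that less.prems ji by auto
      have "K $$ (i, j) = (\<Sum>l<n. (if l = i then G $$ (i, i) else 0)
          + (if l = j then G $$ (i, j) * J $$ (j, j) else 0))"
        unfolding K_index[OF less.prems(1,2)]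
        by (intro sum.cong) (use van less.prems J1 in auto)
      also have "\<dots> = G $$ (i, i) + G $$ (i, j) * J $$ (i, i)"
        using less.prems Jij by (simp add: sum.distrib)
      finally have "K $$ (i, j) = G $$ (i, i) + G $$ (i, j) * J $$ (i, i)" .
      \<comment> \<open>Second evaluation: \<open>K $$ (i, j)\<close> is the conjugate of
        \<open>K $$ (j, i)\<close>, which involves only column \<open>i\<close>; that column is
        diagonal by induction and its eigenvalue is real.\<close>
      moreover have "K $$ (i, j) = G $$ (i, j) * J $$ (i, i)"
        using hermitian_mat_index[OF K less.prems(1,2)] hermitian_mat_index[OF G less.prems(1,2)]
          K_eigen[OF less.prems(2,1) col] real_eigen[OF less.prems(1) col] by simp
      ultimately show False using G_nz[OF less.prems(1)] by simp
    qed
  qed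
  have "J = mat_diag n (\<lambda>i. complex_of_real (Re (J $$ (i, i))))"
  proof (rule eq_matI)
    show "J $$ (i, j) = mat_diag n (\<lambda>i. complex_of_real (Re (J $$ (i, i)))) $$ (i, j)"
      if "i < dim_row (mat_diag n (\<lambda>i. complex_of_real (Re (J $$ (i, i)))))"
        "j < dim_col (mat_diag n (\<lambda>i. complex_of_real (Re (J $$ (i, i)))))" for i j
      using that diag real_eigen[of j] by (auto simp: mat_diag_def complex_eq_iff)
  qed (use J in \<open>auto simp: mat_diag_def\<close>)
  then show thesis using that[OF PQ, of "\<lambda>i. Re (J $$ (i, i))"] HJ by simp
qed

section \<open>Functional calculus\<close>

text \<open>With every dimension fixed at \<open>n\<close>, the carrier premises can be discharged
  during rewriting and products reassociate freely.\<close>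

lemmas square_mat_simps = mult_carrier_mat[of _ n n _ n] assoc_mult_mat[of _ n n _ n _ n]
  left_mult_one_mat[of _ n n] right_mult_one_mat[of _ n n] for n

abbreviation real_diag :: "nat \<Rightarrow> (nat \<Rightarrow> real) \<Rightarrow> complex mat" where
  "real_diag n d \<equiv> mat_diag n (\<lambda>i. complex_of_real (d i))"

text \<open>No orthonormal eigenbasis is demanded: an invertible \<open>P\<close> and real
  \<open>d\<close> suffice for the calculus. The price is that Hermitian symmetry of
  \<open>mat_fun\<close> takes an argument of its own.\<close>

definition diagonalisation ::
    "nat \<Rightarrow> complex mat \<Rightarrow> complex mat \<Rightarrow> (nat \<Rightarrow> real) \<Rightarrow> complex mat \<Rightarrow> bool" where
  "diagonalisation n P Q d H \<longleftrightarrow> P \<in> carrier_mat n n \<and> Q \<in> carrier_mat n n \<and>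
     P * Q = 1\<^sub>m n \<and> Q * P = 1\<^sub>m n \<and> H = P * real_diag n d * Q"

lemma diagonalisationD:
  assumes "diagonalisation n P Q d H"
  shows "P \<in> carrier_mat n n" "Q \<in> carrier_mat n n" "P * Q = 1\<^sub>m n" "Q * P = 1\<^sub>m n"
    "H = P * real_diag n d * Q" "H \<in> carrier_mat n n"
  using assms by (auto simp: diagonalisation_def)

text \<open>Writing \<open>W = S X P\<close>, the hypothesis says \<open>W\<^sub>i\<^sub>j d\<^sub>j = e\<^sub>i W\<^sub>i\<^sub>j\<close>, so \<open>W\<^sub>i\<^sub>j = 0\<close> unless \<open>d\<^sub>j = e\<^sub>i\<close>.\<close>

lemma diagonalisation_intertwine:
  fixes f :: "real \<Rightarrow> real"
  assumes H: "diagonalisation n P Q d H" and K: "diagonalisation n R S e K"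
    and X: "X \<in> carrier_mat n n" and XH: "X * H = K * X"
  shows "X * (P * real_diag n (\<lambda>i. f (d i)) * Q) = R * real_diag n (\<lambda>i. f (e i)) * S * X"
proof -
  note PQ = diagonalisationD[OF H] and RS = diagonalisationD[OF K]
  define W where "W = S * X * P"
  have W: "W \<in> carrier_mat n n" unfolding W_def using PQ(1) RS(2) X by simp
  let ?D = "real_diag n d" and ?E = "real_diag n e"
  let ?D' = "real_diag n (\<lambda>i. f (d i))" and ?E' = "real_diag n (\<lambda>i. f (e i))"
  have D: "?D \<in> carrier_mat n n" "?E \<in> carrier_mat n n" "?D' \<in> carrier_mat n n" "?E' \<in> carrier_mat n n"
    by simp_all
  note c = PQ(1,2) RS(1,2) X D W square_mat_simps[where n = n]
  have RW: "R * W = X * P"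
  proof -
    have "R * W = (R * S) * (X * P)" unfolding W_def by (simp add: c)
    then show ?thesis using RS(3) by (simp add: c)
  qed
  have WQ: "W * Q = S * X"
  proof -
    have "W * Q = (S * X) * (P * Q)" unfolding W_def by (simp add: c)
    then show ?thesis using PQ(3) by (simp add: c)
  qed
  have "W * ?D = ?E * W"
  proof -
    have "W * ?D = S * X * (P * ?D * (Q * P))" unfolding W_def PQ(4) by (simp add: c)
    also have "\<dots> = S * (X * H) * P" unfolding PQ(5) by (simp add: c)
    also have "\<dots> = (S * R) * ?E * S * X * P" unfolding XH RS(5) by (simp add: c)
    also have "\<dots> = ?E * W" unfolding RS(4) W_def by (simp add: c)
    finally show ?thesis .
  qed
  then have eq: "W $$ (i, j) * d j = e i * W $$ (i, j)" if "i < n" "j < n" for i j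
    using that W by (simp add: mat_diag_mult_left[OF W] mat_diag_mult_right[OF W] mat_eq_iff)
  have eq': "W $$ (i, j) * f (d j) = f (e i) * W $$ (i, j)" if "i < n" "j < n" for i j
    using eq[OF that] by (cases "W $$ (i, j) = 0") auto
  have WD': "W * ?D' = ?E' * W"
    unfolding mat_diag_mult_left[OF W] mat_diag_mult_right[OF W] by (intro cong_mat) (use eq' in auto)
  have "X * (P * ?D' * Q) = (X * P) * ?D' * Q" by (simp add: c)
  also have "\<dots> = R * (W * ?D') * Q" unfolding RW[symmetric] by (simp add: c)
  also have "\<dots> = R * ?E' * (W * Q)" unfolding WD' by (simp add: c)
  also have "\<dots> = R * ?E' * S * X" unfolding WQ by (simp add: c)
  finally show ?thesis .
qed

text \<open>No diagonalisation of \<open>H\<close> is canonical, so the description ranges over all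
  of them; \<open>mat_fun_eq\<close> shows that they agree on the value.\<close>

definition mat_fun :: "nat \<Rightarrow> (real \<Rightarrow> real) \<Rightarrow> complex mat \<Rightarrow> complex mat" where
  "mat_fun n f H =
     (THE K. \<exists>P Q d. diagonalisation n P Q d H \<and> K = P * real_diag n (\<lambda>i. f (d i)) * Q)"

lemma mat_fun_eq:
  assumes H: "diagonalisation n P Q d H"
  shows "mat_fun n f H = P * real_diag n (\<lambda>i. f (d i)) * Q"
  unfolding mat_fun_def
proof (rule the_equality)
  fix K assume "\<exists>P Q d. diagonalisation n P Q d H \<and> K = P * real_diag n (\<lambda>i. f (d i)) * Q"
  then obtain P' Q' d' where H': "diagonalisation n P' Q' d' H"
    and K: "K = P' * real_diag n (\<lambda>i. f (d' i)) * Q'" by blast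
  note c = diagonalisationD[OF H] diagonalisationD[OF H']
  have "1\<^sub>m n * (P' * real_diag n (\<lambda>i. f (d' i)) * Q') = P * real_diag n (\<lambda>i. f (d i)) * Q * 1\<^sub>m n"
    by (rule diagonalisation_intertwine[OF H' H]) (use c(6) in auto)
  then show "K = P * real_diag n (\<lambda>i. f (d i)) * Q"
    unfolding K by (simp add: c(1,2,7,8) square_mat_simps[where n = n])
qed (use H in blast)

section \<open>Rules of the functional calculus for Hermitian matrices\<close>

lemma hermitian_obtain_diagonalisation:
  assumes "hermitian_mat n H"
  obtains P Q d where "diagonalisation n P Q d H"
proof (rule hermitian_diagonalisable[OF assms])
  fix P Q d assume "P \<in> carrier_mat n n" "Q \<in> carrier_mat n n" "P * Q = 1\<^sub>m n" "Q * P = 1\<^sub>m n"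
    "H = P * real_diag n d * Q"
  then show thesis by (intro that[of P Q d]) (simp add: diagonalisation_def)
qed

lemma mat_fun_diagonalisation:
  assumes "diagonalisation n P Q d H"
  shows "diagonalisation n P Q (\<lambda>i. f (d i)) (mat_fun n f H)"
  using assms mat_fun_eq[OF assms] by (simp add: diagonalisation_def)

lemma mat_fun_carrier:
  assumes "hermitian_mat n H"
  shows "mat_fun n f H \<in> carrier_mat n n"
proof -
  obtain P Q d where D: "diagonalisation n P Q d H"
    using hermitian_obtain_diagonalisation[OF assms] .
  show ?thesis by (rule diagonalisationD(6)[OF mat_fun_diagonalisation[OF D]])
qed

lemma mat_fun_intertwine:
  assumes "hermitian_mat n H" "hermitian_mat n K" and X: "X \<in> carrier_mat n n" and XH: "X * H = K * X"
  shows "X * mat_fun n f H = mat_fun n f K * X"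
proof -
  obtain P Q d where H: "diagonalisation n P Q d H"
    using hermitian_obtain_diagonalisation[OF assms(1)] .
  obtain R S e where K: "diagonalisation n R S e K"
    using hermitian_obtain_diagonalisation[OF assms(2)] .
  show ?thesis unfolding mat_fun_eq[OF H] mat_fun_eq[OF K]
    by (rule diagonalisation_intertwine[OF H K X XH])
qed

text \<open>Taking adjoints in \<open>H = P D Q\<close> gives another diagonalisation of
  \<open>H\<close>, with the basis \<open>mat_adjoint Q\<close> and the same real \<open>d\<close>.
  Independence of the choice identifies the adjoint of f(H) with f(H).\<close>

lemma mat_fun_hermitian:
  assumes H: "hermitian_mat n H"
  shows "hermitian_mat n (mat_fun n f H)"
proof -
  obtain P Q d where D: "diagonalisation n P Q d H"
    using hermitian_obtain_diagonalisation[OF H] .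
  note PQ = diagonalisationD[OF D]
  note P' = mat_adjoint_carrier[OF PQ(1)] and Q' = mat_adjoint_carrier[OF PQ(2)]
  have adj: "mat_adjoint (P * real_diag n e * Q) = mat_adjoint Q * real_diag n e * mat_adjoint P" for e
  proof -
    have "mat_adjoint (P * real_diag n e * Q) = mat_adjoint Q * mat_adjoint (P * real_diag n e)"
      by (rule mat_adjoint_mult[of _ n n]) (use PQ in auto)
    also have "mat_adjoint (P * real_diag n e) = real_diag n e * mat_adjoint P"
      using mat_adjoint_mult[OF PQ(1) mat_diag_dim] by (simp add: mat_adjoint_real_diag)
    finally show ?thesis by (simp add: P' Q' square_mat_simps[where n = n])
  qed
  have "diagonalisation n (mat_adjoint Q) (mat_adjoint P) d H"
    unfolding diagonalisation_def
  proof (intro conjI P' Q')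
    show "mat_adjoint Q * mat_adjoint P = 1\<^sub>m n" "mat_adjoint P * mat_adjoint Q = 1\<^sub>m n"
      unfolding mat_adjoint_mult[OF PQ(1,2), symmetric] mat_adjoint_mult[OF PQ(2,1), symmetric]
        PQ(3,4) by (rule mat_adjoint_one)+
    show "H = mat_adjoint Q * real_diag n d * mat_adjoint P"
      using adj[of d] hermitian_matD(2)[OF H] unfolding PQ(5) by metis
  qed
  then have "mat_adjoint (mat_fun n f H) = mat_fun n f H"
    unfolding mat_fun_eq[OF D] adj by (simp only: mat_fun_eq flip: mat_fun_eq[OF D])
  then show ?thesis using mat_fun_carrier[OF H] by (simp add: hermitian_mat_def)
qed

lemma mat_fun_compose:
  assumes H: "hermitian_mat n H"
  shows "mat_fun n g (mat_fun n f H) = mat_fun n (\<lambda>x. g (f x)) H"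
proof -
  obtain P Q d where D: "diagonalisation n P Q d H"
    using hermitian_obtain_diagonalisation[OF H] .
  show ?thesis
    unfolding mat_fun_eq[OF mat_fun_diagonalisation[OF D]] by (rule mat_fun_eq[OF D, symmetric])
qed

lemma mat_fun_mult:
  assumes H: "hermitian_mat n H"
  shows "mat_fun n f H * mat_fun n g H = mat_fun n (\<lambda>x. f x * g x) H"
proof -
  obtain P Q d where D: "diagonalisation n P Q d H"
    using hermitian_obtain_diagonalisation[OF H] .
  note PQ = diagonalisationD[OF D]
  let ?F = "real_diag n (\<lambda>i. f (d i))" and ?G = "real_diag n (\<lambda>i. g (d i))"
  note c = PQ(1,2) mat_diag_dim[of n] square_mat_simps[where n = n]
  have "P * ?F * Q * (P * ?G * Q) = P * ?F * (Q * P) * ?G * Q" by (simp add: c)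
  also have "\<dots> = P * (?F * ?G) * Q" unfolding PQ(4) by (simp add: c del: mat_diag_diag)
  finally show ?thesis by (simp add: mat_fun_eq[OF D])
qed

lemma mat_fun_id:
  assumes "hermitian_mat n H"
  shows "mat_fun n (\<lambda>x. x) H = H"
proof -
  obtain P Q d where D: "diagonalisation n P Q d H"
    using hermitian_obtain_diagonalisation[OF assms] .
  show ?thesis using mat_fun_eq[OF D] diagonalisationD(5)[OF D] by simp
qed

lemma mat_fun_one:
  assumes "hermitian_mat n H"
  shows "mat_fun n (\<lambda>x. 1) H = 1\<^sub>m n"
proof -
  obtain P Q d where D: "diagonalisation n P Q d H"
    using hermitian_obtain_diagonalisation[OF assms] .
  show ?thesis
    unfolding mat_fun_eq[OF D] using diagonalisationD(1-4)[OF D] by simp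
qed

lemma mat_fun_uminus:
  assumes "hermitian_mat n H"
  shows "mat_fun n (\<lambda>x. - f x) H = - mat_fun n f H"
proof -
  obtain P Q d where D: "diagonalisation n P Q d H"
    using hermitian_obtain_diagonalisation[OF assms] .
  note PQ = diagonalisationD[OF D]
  have "real_diag n (\<lambda>i. - f (d i)) = - real_diag n (\<lambda>i. f (d i))"
    by (intro eq_matI) (auto simp: mat_diag_def)
  then show ?thesis unfolding mat_fun_eq[OF D] using PQ(1,2) by (simp add: mat_diag_def)
qed

text \<open>f(H) is the square of the Hermitian matrix obtained from the square root of
  \<open>f\<close>, whose inverse comes from the reciprocal function; so it is a Gram matrix of an
  invertible matrix.\<close>

lemma mat_fun_pos_def:
  assumes H: "hermitian_mat n H" and f: "\<And>x. f x > 0"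
  shows "hermitian_pos_def n (mat_fun n f H)"
proof -
  let ?g = "\<lambda>x. sqrt (f x)"
  have X: "hermitian_mat n (mat_fun n ?g H)" by (rule mat_fun_hermitian[OF H])
  have "hermitian_pos_def n (mat_adjoint (mat_fun n ?g H) * mat_fun n ?g H)"
  proof (rule hermitian_pos_def_adjoint_mult)
    show "mat_fun n (\<lambda>x. inverse (?g x)) H * mat_fun n ?g H = 1\<^sub>m n"
      using f by (simp add: mat_fun_mult[OF H] mat_fun_one[OF H] less_imp_neq[symmetric])
  qed (rule mat_fun_carrier[OF H])+
  moreover have "mat_adjoint (mat_fun n ?g H) * mat_fun n ?g H = mat_fun n f H"
    using hermitian_matD(2)[OF X] f by (simp add: mat_fun_mult[OF H] less_imp_le)
  ultimately show ?thesis by simp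
qed

text \<open>All eigenvalues of \<open>H\<close> are positive. This admits identities for
  \<open>ln\<close>, \<open>sqrt\<close> and \<open>inverse\<close> that hold only on the positive
  reals.\<close>

lemma mat_fun_cong_pos_def:
  assumes H: "hermitian_pos_def n H" and fg: "\<And>x. x > 0 \<Longrightarrow> f x = g x"
  shows "mat_fun n f H = mat_fun n g H"
proof -
  obtain P Q d where D: "diagonalisation n P Q d H"
    using hermitian_obtain_diagonalisation[OF hermitian_pos_def_imp_hermitian[OF H]] .
  note PQ = diagonalisationD[OF D]
  have "d i > 0" if i: "i < n" for i
  proof -
    let ?v = "col P i"
    have v: "?v \<in> carrier_vec n" using PQ(1) i by auto
    have "H * P = P * real_diag n d * (Q * P)"
      unfolding PQ(5) by (simp add: PQ(1,2) square_mat_simps[where n = n])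
    then have HP: "H * P = P * real_diag n d"
      unfolding PQ(4) by (simp add: PQ(1) square_mat_simps[where n = n])
    \<comment> \<open>Column \<open>i\<close> of \<open>P\<close> is an eigenvector for
      \<open>d i\<close>, so the positive form at it equals \<open>d i\<close> times its squared
      norm.\<close>
    have ev: "H *\<^sub>v ?v = complex_of_real (d i) \<cdot>\<^sub>v ?v"
    proof -
      have "H *\<^sub>v ?v = col (H * P) i" using col_mult2[OF PQ(6,1) i] by simp
      also have "\<dots> = complex_of_real (d i) \<cdot>\<^sub>v ?v"
        unfolding HP mat_diag_mult_right[OF PQ(1)] using PQ(1) i by (intro eq_vecI) (auto simp: mult.commute)
      finally show ?thesis .
    qed
    have "(Q * P) $$ (i, i) = row Q i \<bullet> ?v" using PQ(1,2) i by simp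
    then have nz: "?v \<noteq> 0\<^sub>v n" using PQ(2,4) i by auto
    have "0 < Re ((H *\<^sub>v ?v) \<bullet>c ?v)" using H v nz by (auto simp: hermitian_pos_def_def)
    also have "\<dots> = d i * Re (?v \<bullet>c ?v)" unfolding ev using v by simp
    finally show ?thesis
      using conjugate_square_greater_0_vec[OF v] nz
      by (simp add: less_complex_def zero_less_mult_iff)
  qed
  then have "real_diag n (\<lambda>i. f (d i)) = real_diag n (\<lambda>i. g (d i))"
    using fg by (intro eq_matI) (auto simp: mat_diag_def)
  then show ?thesis by (simp add: mat_fun_eq[OF D])
qed

section \<open>Exponential and square root through the functional calculus\<close>

lemma diagonalisation_pow:
  assumes D: "diagonalisation n P Q d H"
  shows "H ^\<^sub>m k = P * real_diag n (\<lambda>i. d i ^ k) * Q"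
proof (induction k)
  case 0
  have "dim_row H = n" using diagonalisationD(6)[OF D] by auto
  then show ?case using diagonalisationD(1-4)[OF D] by simp
next
  case (Suc k)
  note PQ = diagonalisationD[OF D]
  let ?F = "real_diag n (\<lambda>i. d i ^ k)" and ?G = "real_diag n d"
  note c = PQ(1,2) mat_diag_dim[of n] square_mat_simps[where n = n]
  have "P * ?F * Q * (P * ?G * Q) = P * ?F * (Q * P) * ?G * Q" by (simp add: c)
  also have "\<dots> = P * (?F * ?G) * Q" unfolding PQ(4) by (simp add: c del: mat_diag_diag)
  finally show ?case unfolding pow_mat.simps(2) Suc by (simp add: mult.commute flip: PQ(5))
qed

text \<open>Each entry of the k-th power is a combination of the numbers \<open>d l ^ k\<close> with
  coefficients that do not depend on \<open>k\<close>. The entrywise series is thus a finite sum of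
  scalar exponential series.\<close>

lemma mat_exp_eq_mat_fun:
  assumes "hermitian_mat n H"
  shows "mat_exp H = mat_fun n exp H"
proof -
  obtain P Q d where D: "diagonalisation n P Q d H"
    using hermitian_obtain_diagonalisation[OF assms] .
  note PQ = diagonalisationD[OF D]
  have ix: "(P * real_diag n e * Q) $$ (i, j) = (\<Sum>l<n. P $$ (i, l) * Q $$ (l, j) * e l)"
    if "i < n" "j < n" for e :: "nat \<Rightarrow> real" and i j
  proof -
    have R: "P * real_diag n e \<in> carrier_mat n n" using PQ(1) by simp
    show ?thesis
      unfolding mult_mat_index[OF R PQ(2) that]
      by (intro sum.cong) (use that PQ(1) in \<open>auto simp: mat_diag_mult_right[OF PQ(1)]\<close>)
  qed
  show ?thesis
  proof (rule eq_matI)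
    fix i j assume "i < dim_row (mat_fun n exp H)" "j < dim_col (mat_fun n exp H)"
    then have ij: "i < n" "j < n" using mat_fun_carrier[OF assms, of exp] by auto
    have "(\<lambda>k. \<Sum>l<n. P $$ (i, l) * Q $$ (l, j) * complex_of_real (d l ^ k /\<^sub>R fact k)) sums
        (\<Sum>l<n. P $$ (i, l) * Q $$ (l, j) * complex_of_real (exp (d l)))"
      by (intro sums_sum sums_mult sums_of_real exp_converges)
    moreover have "(\<Sum>l<n. P $$ (i, l) * Q $$ (l, j) * complex_of_real (d l ^ k /\<^sub>R fact k))
        = (H ^\<^sub>m k) $$ (i, j) / fact k" for k
      unfolding diagonalisation_pow[OF D] ix[OF ij] sum_divide_distrib
      by (intro sum.cong) (auto simp: field_simps)
    ultimately have "(\<lambda>k. (H ^\<^sub>m k) $$ (i, j) / fact k) sums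
        (\<Sum>l<n. P $$ (i, l) * Q $$ (l, j) * complex_of_real (exp (d l)))" by simp
    then show "mat_exp H $$ (i, j) = mat_fun n exp H $$ (i, j)"
      unfolding mat_fun_eq[OF D] ix[OF ij] using ij PQ(6) by (simp add: mat_exp_def sums_iff)
  qed (use mat_fun_carrier[OF assms, of exp] PQ(6) in \<open>auto simp: mat_exp_def\<close>)
qed

text \<open>Real spectrum is what makes this work, as \<open>ln\<close> inverts \<open>exp\<close>
  on the reals; for general complex matrices the periodicity of exp breaks injectivity.\<close>

lemma mat_exp_inj_on_hermitian:
  assumes Y: "hermitian_mat n Y" and Z: "hermitian_mat n Z" and eq: "mat_exp Y = mat_exp Z"
  shows "Y = Z"
proof -
  have ln: "mat_fun n ln (mat_exp X) = X" if "hermitian_mat n X" for X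
    unfolding mat_exp_eq_mat_fun[OF that] by (simp add: mat_fun_compose[OF that] mat_fun_id[OF that])
  show ?thesis using ln[OF Y] ln[OF Z] eq by metis
qed

text \<open>The candidate \<open>S\<close> supplies existence for the definite description.
  Uniqueness holds because applying \<open>sqrt\<close> to the square of any positive definite
  matrix returns that matrix.\<close>

lemma mat_sqrt_eqI:
  assumes S: "hermitian_pos_def n S"
  shows "mat_sqrt (S * S) = S"
proof -
  have root: "mat_fun n sqrt (T * T) = T" if T: "hermitian_pos_def n T" for T
  proof -
    note H = hermitian_pos_def_imp_hermitian[OF T]
    have "T * T = mat_fun n (\<lambda>x. x * x) T"
      using mat_fun_mult[OF H, of "\<lambda>x. x" "\<lambda>x. x"] unfolding mat_fun_id[OF H] .
    then have "mat_fun n sqrt (T * T) = mat_fun n (\<lambda>x. sqrt (x * x)) T"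
      by (simp add: mat_fun_compose[OF H])
    \<comment> \<open>Positive definiteness enters here: \<open>sqrt (x * x) = x\<close> fails for
      negative \<open>x\<close>.\<close>
    also have "\<dots> = mat_fun n (\<lambda>x. x) T"
      by (rule mat_fun_cong_pos_def[OF T]) simp
    finally show ?thesis by (simp add: mat_fun_id[OF H])
  qed
  have dim: "dim_row (S * S) = n" using S by (auto simp: hermitian_pos_def_def)
  show ?thesis
    unfolding mat_sqrt_def dim
  proof (rule the_equality)
    fix T assume T: "hermitian_pos_def n T \<and> T * T = S * S"
    have "T = mat_fun n sqrt (T * T)" using root conjunct1[OF T] by metis
    also have "\<dots> = S" unfolding conjunct2[OF T] by (rule root[OF S])
    finally show "T = S" .
  qed (use S in simp)
qed

section \<open>The polar decomposition in \<open>U(p,q)\<close>\<close>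

lemma add_eq_zero_mat_iff:
  fixes A B :: "complex mat"
  assumes A: "A \<in> carrier_mat n m" and B: "B \<in> carrier_mat n m"
  shows "A + B = 0\<^sub>m n m \<longleftrightarrow> B = - A"
  using assms by (auto simp: mat_eq_iff add_eq_0_iff)

lemma I_pq_square: "I_pq p q * I_pq p q = 1\<^sub>m (p + q)"
proof (rule eq_matI)
  fix i j assume "i < dim_row (1\<^sub>m (p + q) :: complex mat)" "j < dim_col (1\<^sub>m (p + q) :: complex mat)"
  then have ij: "i < p + q" "j < p + q" by auto
  have "(I_pq p q * I_pq p q) $$ (i, j) = (\<Sum>l<p + q. if l = i then (if i = j then 1 else 0) else 0)"
    unfolding mult_mat_index[OF I_pq_carrier I_pq_carrier ij]
    by (intro sum.cong) (use ij in \<open>auto simp: I_pq_index\<close>)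
  then show "(I_pq p q * I_pq p q) $$ (i, j) = 1\<^sub>m (p + q) $$ (i, j)" using ij by simp
qed (use I_pq_carrier[of p q] in auto)

text \<open>For Hermitian \<open>Y\<close> the equation defining \<open>u_pq\<close> is exactly
  anticommutation with \<open>I_pq\<close>, a form to which \<open>mat_fun_intertwine\<close>
  applies.\<close>

lemma n_space_iff:
  "Y \<in> n_space p q \<longleftrightarrow> hermitian_mat (p + q) Y \<and> I_pq p q * Y = - (Y * I_pq p q)"
proof
  assume Y: "Y \<in> n_space p q"
  then have u: "Y \<in> u_pq p q" by (simp add: n_space_def)
  then have Yc: "Y \<in> carrier_mat (p + q) (p + q)" by (simp add: u_pq_def)
  note Y' = mat_adjoint_carrier[OF Yc]
  from Y obtain B where B: "B \<in> carrier_mat p q"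
    and Y_eq: "Y = four_block_mat (0\<^sub>m p p) B (mat_adjoint B) (0\<^sub>m q q)"
    unfolding n_space_explicit by blast
  have sym: "cnj (Y $$ (j, i)) = Y $$ (i, j)" if "i < p + q" "j < p + q" for i j
    using that B mat_adjoint_carrier[OF B] by (auto simp: Y_eq mat_adjoint_index[OF B])
  have herm: "mat_adjoint Y = Y"
    by (rule eq_matI) (use Yc Y' in \<open>simp_all add: mat_adjoint_index[OF Yc] sym\<close>)
  have "mat_adjoint Y * I_pq p q + I_pq p q * Y = 0\<^sub>m (p + q) (p + q)"
    using u by (simp add: u_pq_def)
  then have "I_pq p q * Y = - (Y * I_pq p q)"
    unfolding herm
    by (rule add_eq_zero_mat_iff[THEN iffD1, rotated 2])
      (rule mult_carrier_mat[OF Yc I_pq_carrier] mult_carrier_mat[OF I_pq_carrier Yc])+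
  then show "hermitian_mat (p + q) Y \<and> I_pq p q * Y = - (Y * I_pq p q)"
    using Yc herm by (simp add: hermitian_mat_def)
next
  assume R: "hermitian_mat (p + q) Y \<and> I_pq p q * Y = - (Y * I_pq p q)"
  then have Yc: "Y \<in> carrier_mat (p + q) (p + q)" and herm: "mat_adjoint Y = Y"
    by (auto simp: hermitian_mat_def)
  have "mat_adjoint Y * I_pq p q + I_pq p q * Y = 0\<^sub>m (p + q) (p + q)"
    unfolding herm
    by (rule add_eq_zero_mat_iff[THEN iffD2])
      (rule mult_carrier_mat[OF Yc I_pq_carrier] mult_carrier_mat[OF I_pq_carrier Yc]
        conjunct2[OF R])+
  then have u: "Y \<in> u_pq p q" using Yc by (simp add: u_pq_def)
  have idx: "cnj (Y $$ (j, i)) = Y $$ (i, j)" if "i < p + q" "j < p + q" for i j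
    using mat_adjoint_index[OF Yc that] herm by simp
  \<comment> \<open>Inside a diagonal block the two signs agree, so the equation of
    \<open>u_pq\<close> and Hermitian symmetry together force twice the entry to be zero.\<close>
  have van: "Y $$ (i, j) = 0" if "i < p + q" "j < p + q" "i < p \<longleftrightarrow> j < p" for i j
  proof -
    have "cnj (Y $$ (j, i)) * (if j < p then 1 else - 1) + (if i < p then 1 else - 1) * Y $$ (i, j) = 0"
      using u that unfolding u_pq_iff by blast
    then show ?thesis
      unfolding idx[OF that(1,2)] using that(3) by (simp split: if_splits)
  qed
  have "mat_trace (mat_adjoint Y * Z) = 0" if "Z \<in> u_p_plus_u_q p q" for Z
  proof -
    from that obtain a d where "a \<in> carrier_mat p p" "d \<in> carrier_mat q q"
      and Z: "Z = four_block_mat a (0\<^sub>m p q) (0\<^sub>m q p) d"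
      by (auto simp: u_p_plus_u_q_def u_skew_def)
    then have Zc: "Z \<in> carrier_mat (p + q) (p + q)"
      and Z0: "\<And>i j. i < p + q \<Longrightarrow> j < p + q \<Longrightarrow> \<not> (i < p \<longleftrightarrow> j < p) \<Longrightarrow> Z $$ (i, j) = 0"
      by auto
    have "cnj (Y $$ (j, i)) * Z $$ (j, i) = 0" if "i < p + q" "j < p + q" for i j
      using van[of j i] Z0[of j i] that by auto
    then show ?thesis unfolding trace_adjoint_mult[OF Yc Zc] by (intro sum.neutral ballI) simp_all
  qed
  then show "Y \<in> n_space p q" using u by (simp add: n_space_def)
qed

text \<open>The adjoint of \<open>A\<close> preserves the form as well, that is
  \<open>A I A^* = I\<close>; the product then collapses from the inside out.\<close>

lemma gram_preserves_I_pq: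
  assumes A: "A \<in> U_pq p q"
  shows "mat_adjoint A * A * I_pq p q * (mat_adjoint A * A) = I_pq p q"
proof -
  let ?n = "p + q" and ?I = "I_pq p q" and ?A' = "mat_adjoint A"
  have Ac: "A \<in> carrier_mat ?n ?n" and AIA: "?A' * ?I * A = ?I" using A by (auto simp: U_pq_def)
  note c = Ac mat_adjoint_carrier[OF Ac] I_pq_carrier[of p q] square_mat_simps[where n = ?n]
  \<comment> \<open>Since \<open>I_pq\<close> squares to 1, \<open>I A^* I\<close> is a left inverse
    of \<open>A\<close>; for square matrices it is also a right inverse.\<close>
  have "(?I * ?A' * ?I) * A = ?I * (?A' * ?I * A)" by (simp add: c)
  also have "\<dots> = 1\<^sub>m ?n" unfolding AIA by (rule I_pq_square)
  finally have inv: "A * (?I * ?A' * ?I) = 1\<^sub>m ?n"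
    by (rule mat_mult_left_right_inverse[rotated 2]) (rule c)+
  have "A * ?I * ?A' = A * ?I * ?A' * (?I * ?I)" unfolding I_pq_square by (simp add: c)
  also have "\<dots> = A * (?I * ?A' * ?I) * ?I" by (simp add: c)
  also have "\<dots> = ?I" unfolding inv by (simp add: c)
  finally have AIA': "A * ?I * ?A' = ?I" .
  have "?A' * A * ?I * (?A' * A) = ?A' * (A * ?I * ?A') * A" by (simp add: c)
  also have "\<dots> = ?I" unfolding AIA' by (rule AIA)
  finally show ?thesis .
qed

text \<open>The hypothesis says that \<open>I_pq\<close> intertwines \<open>P\<close> with its
  inverse, and the logarithm turns inversion into a change of sign. The factor 1/2 is there because
  the exponential has to be the square root of \<open>P\<close>.\<close>

lemma half_log_in_n_space:
  assumes P: "hermitian_pos_def (p + q) P" and PIP: "P * I_pq p q * P = I_pq p q"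
  shows "mat_fun (p + q) (\<lambda>x. ln x / 2) P \<in> n_space p q"
proof -
  let ?n = "p + q" and ?I = "I_pq p q" and ?f = "\<lambda>x :: real. ln x / 2"
  note H = hermitian_pos_def_imp_hermitian[OF P]
  note Pc = hermitian_matD(1)[OF H] and I = I_pq_carrier[of p q]
  let ?R = "mat_fun ?n inverse P"
  have Rc: "?R \<in> carrier_mat ?n ?n" by (rule mat_fun_carrier[OF H])
  have "?R * P = mat_fun ?n (\<lambda>x. inverse x * x) P"
    using mat_fun_mult[OF H, of inverse "\<lambda>x. x"] mat_fun_id[OF H] by simp
  also have "\<dots> = mat_fun ?n (\<lambda>x. 1) P" by (rule mat_fun_cong_pos_def[OF P]) simp
  finally have RP: "?R * P = 1\<^sub>m ?n" by (simp add: mat_fun_one[OF H])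
  have "?I * P = (?R * P) * (?I * P)" unfolding RP using I Pc by simp
  also have "\<dots> = ?R * (P * ?I * P)"
    by (simp add: I Pc Rc square_mat_simps[where n = ?n])
  finally have "?I * P = ?R * ?I" unfolding PIP .
  then have "?I * mat_fun ?n ?f P = mat_fun ?n ?f ?R * ?I"
    by (rule mat_fun_intertwine[OF H mat_fun_hermitian[OF H] I])
  also have "mat_fun ?n ?f ?R = mat_fun ?n (\<lambda>x. - ?f x) P"
    unfolding mat_fun_compose[OF H] by (rule mat_fun_cong_pos_def[OF P]) (simp add: ln_inverse)
  also have "\<dots> * ?I = - (mat_fun ?n ?f P * ?I)"
    using mat_fun_carrier[OF H, of ?f] I by (simp add: mat_fun_uminus[OF H])
  finally show ?thesis unfolding n_space_iff using mat_fun_hermitian[OF H] by simp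
qed

theorem theorem5p2p1:
  fixes p q n :: nat and A :: "complex mat"
  assumes "0 < p" and "0 < q" and "n = p + q"
    and "A \<in> U_pq p q"
  shows "(\<exists>!Y. Y \<in> n_space p q \<and> mat_sqrt (mat_adjoint A * A) = mat_exp Y) \<and>
    (\<exists>!UE. case UE of (U, E) \<Rightarrow>
       unitary_mat n U \<and> E \<in> mat_exp ` n_space p q \<and> A = U * E) \<and>
    (unitary_mat n (A * the (mat_inverse (mat_sqrt (mat_adjoint A * A)))) \<and>
     mat_sqrt (mat_adjoint A * A) \<in> mat_exp ` n_space p q \<and>
     A = A * the (mat_inverse (mat_sqrt (mat_adjoint A * A))) * mat_sqrt (mat_adjoint A * A))"
proof -
  have Ac: "A \<in> carrier_mat n n" and "invertible_mat A" using assms by (auto simp: U_pq_def)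
  then obtain Z where AZ: "inverts_mat A Z" "inverts_mat Z A"
    by (auto simp: invertible_mat_def)
  \<comment> \<open>\<open>inverts_mat\<close> does not state the shape of \<open>Z\<close>;
    comparing column counts in the two identities yields it.\<close>
  have "dim_col (A * Z) = dim_col (1\<^sub>m n :: complex mat)"
    "dim_col (Z * A) = dim_col (1\<^sub>m (dim_row Z) :: complex mat)"
    using AZ Ac by (simp_all only: inverts_mat_def carrier_matD)
  then have Z: "Z \<in> carrier_mat n n" using Ac by auto
  have ZA: "Z * A = 1\<^sub>m n" using AZ(2) Z by (simp add: inverts_mat_def)
  define P where "P = mat_adjoint A * A"
  have P: "hermitian_pos_def n P"
    unfolding P_def by (rule hermitian_pos_def_adjoint_mult[OF Ac Z ZA])
  note H = hermitian_pos_def_imp_hermitian[OF P]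
  define Y where "Y = mat_fun n (\<lambda>x. ln x / 2) P"
  have Yn: "Y \<in> n_space p q"
    using half_log_in_n_space[of p q P] P gram_preserves_I_pq[OF assms(4)] assms(3)
    by (simp add: Y_def P_def)
  have herm: "hermitian_mat n X" if "X \<in> n_space p q" for X
    using that assms(3) by (simp add: n_space_iff)
  have exp_pos: "hermitian_pos_def n (mat_exp X)" if "X \<in> n_space p q" for X
    unfolding mat_exp_eq_mat_fun[OF herm[OF that]] by (rule mat_fun_pos_def[OF herm[OF that]]) simp
  define S where "S = mat_exp Y"
  have S: "hermitian_pos_def n S" unfolding S_def by (rule exp_pos[OF Yn])
  note SH = hermitian_matD[OF hermitian_pos_def_imp_hermitian[OF S]]
  have "S * S = mat_fun n (\<lambda>x. exp (ln x / 2) * exp (ln x / 2)) P"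
    unfolding S_def mat_exp_eq_mat_fun[OF herm[OF Yn]] unfolding Y_def mat_fun_compose[OF H]
    by (rule mat_fun_mult[OF H])
  also have "\<dots> = mat_fun n (\<lambda>x. x) P"
    by (rule mat_fun_cong_pos_def[OF P]) (simp flip: exp_add)
  finally have SS: "S * S = P" by (simp add: mat_fun_id[OF H])
  have root: "mat_sqrt P = S" using mat_sqrt_eqI[OF S] SS by simp
  \<comment> \<open>This is the exponential of \<open>- Y\<close>, an explicit inverse of
    \<open>S\<close> that is visibly Hermitian.\<close>
  define T where "T = mat_fun n (\<lambda>x. exp (- x)) Y"
  have T: "T \<in> carrier_mat n n" "mat_adjoint T = T"
    unfolding T_def by (rule hermitian_matD[OF mat_fun_hermitian[OF herm[OF Yn]]])+
  have TS: "T * S = 1\<^sub>m n"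
    unfolding T_def S_def mat_exp_eq_mat_fun[OF herm[OF Yn]]
    by (simp add: mat_fun_mult[OF herm[OF Yn]] mat_fun_one[OF herm[OF Yn]] flip: exp_add)
  have ST: "S * T = 1\<^sub>m n" by (rule mat_mult_left_right_inverse[OF T(1) SH(1) TS])
  \<comment> \<open>The value \<open>None\<close> is excluded because \<open>T\<close> makes
    \<open>S\<close> a unit; any returned inverse equals \<open>T\<close> by uniqueness of
    inverses.\<close>
  have inv: "the (mat_inverse S) = T"
  proof (cases "mat_inverse S")
    case None
    then have "S \<notin> Units (ring_mat TYPE(complex) n ())" by (rule mat_inverse(1)[OF SH(1)])
    then show ?thesis using SH(1) T(1) TS ST by (auto simp: Units_def ring_mat_simps)
  next
    case (Some B)
    then have B: "S * B = 1\<^sub>m n" "B \<in> carrier_mat n n" using mat_inverse(2)[OF SH(1)] by auto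
    have "T = T * (S * B)" using B(1) T(1) by simp
    also have "\<dots> = (T * S) * B" using T(1) SH(1) B(2) by simp
    finally show ?thesis using TS B(2) Some by simp
  qed
  note c = Ac mat_adjoint_carrier[OF Ac] SH(1) T(1) square_mat_simps[where n = n]
  have U: "unitary_mat n (A * T)"
  proof -
    have "mat_adjoint (A * T) * (A * T) = T * P * T"
      unfolding mat_adjoint_mult[OF Ac T(1)] T(2) P_def by (simp add: c)
    also have "\<dots> = (T * S) * (S * T)" unfolding SS[symmetric] by (simp add: c)
    finally show ?thesis using TS ST c by (simp add: unitary_mat_def)
  qed
  have A_eq: "A = A * T * S" using TS by (simp add: c)
  have S_in: "S \<in> mat_exp ` n_space p q" using Yn by (simp add: S_def)
  \<comment> \<open>The unitary factor cancels in \<open>A^* A\<close>, leaving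
    \<open>P = E * E\<close>. As an exponential of a Hermitian matrix, \<open>E\<close> is positive
    definite, hence the root \<open>S\<close>, and multiplying by \<open>T\<close> recovers
    \<open>U'\<close>.\<close>
  have uniq: "U' = A * T \<and> E = S"
    if U': "unitary_mat n U'" and E: "E \<in> mat_exp ` n_space p q" and A: "A = U' * E" for U' E
  proof -
    have Ep: "hermitian_pos_def n E" using E exp_pos by auto
    note EH = hermitian_matD[OF hermitian_pos_def_imp_hermitian[OF Ep]]
    have U'c: "U' \<in> carrier_mat n n" and UU: "mat_adjoint U' * U' = 1\<^sub>m n"
      using U' by (auto simp: unitary_mat_def)
    note c' = c EH(1) U'c mat_adjoint_carrier[OF U'c]
    have "P = E * (mat_adjoint U' * U') * E"
      unfolding P_def A mat_adjoint_mult[OF U'c EH(1)] EH(2) by (simp add: c')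
    then have "P = E * E" unfolding UU by (simp add: c')
    then have ES: "E = S" using mat_sqrt_eqI[OF Ep] root by simp
    have "A * T = U' * (S * T)" unfolding A ES by (simp add: c')
    then show ?thesis using ST ES U'c by simp
  qed
  have Y_unique: "\<exists>!Y. Y \<in> n_space p q \<and> mat_sqrt P = mat_exp Y"
  proof (rule ex1I[of _ Y])
    show "Y \<in> n_space p q \<and> mat_sqrt P = mat_exp Y" using Yn root by (simp add: S_def)
    fix X assume "X \<in> n_space p q \<and> mat_sqrt P = mat_exp X"
    then show "X = Y"
      using mat_exp_inj_on_hermitian[OF herm herm[OF Yn]] root by (simp add: S_def)
  qed
  have "\<exists>!UE. case UE of (U, E) \<Rightarrow> unitary_mat n U \<and> E \<in> mat_exp ` n_space p q \<and> A = U * E"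
  proof (rule ex1I[of _ "(A * T, S)"])
    show "case (A * T, S) of (U, E) \<Rightarrow> unitary_mat n U \<and> E \<in> mat_exp ` n_space p q \<and> A = U * E"
      using U S_in A_eq by simp
  qed (use uniq in auto)
  then show ?thesis
    using Y_unique U S_in A_eq unfolding P_def[symmetric] root inv by simp
qed

end
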